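(* Let $M$ be a homogeneous metric measure space. Then every weight $w:M\to\mathbb{R}^+$ satisfying $$\mu(\{w\le r\})\le \Upsilon_M(r):=\mu(B(r))\quad\text{for all } r>0$$ is an isoperimetric weight; that is, the class of isoperimetric weights on $M$ contains the class of weights satisfying this growth condition.
   Context: Perimeter and profile. For a Borel set $A\subset M$, $\mu^+(A)=\liminf_{h\to0}\frac{\mu(A_h)-\mu(A)}{h}$ with $A_h=\{x:d(x,A)<h\}$. The isoperimetric profile is $I:[0,\mu(M))\to\mathbb{R}_+$, $I(t)=\inf\{\mu^+(A):\mu(A)=t\}$. Homogeneous metric measure space. This means a space $(M,\mu,d)$ satisfying (a) and (b). (a) $(M,\mu,d)$ is a connected metric space with a Borel measure $\mu$ finite on compact sets, whose isoperimetric profile $I$ is concave, continuous, with $I(0)=0$; if $\mu(M)<\infty$, $I$ is symmetric around $\mu(M)/2$ (hence increasing on $(0,\mu(M)/2)$, decreasing on $(\mu(M)/2,\mu(M))$); if $\mu(M)=\infty$, $I$ is increasing. It is understood that $I>0$ on $(0,\mu(M))$. (b) $M$ satisfies the assumptions of G. M. Dall'Ara and D. Trevisan, "Uncertainty inequalities on groups and homogeneous spaces via isoperimetric inequalities" (J. Geom. Anal. 25 (2015)): $M$ is a homogeneous space of a (Lie or finitely generated) group $G$ with compact isotropy subgroups, and $M$ is endowed with an invariant measure $\mu$, an invariant distance $d$, and an invariant gradient compatible with $d$. All balls $B(r)$ of radius $r$ then have the same measure $\Upsilon_M(r)=\mu(B(r))$. The following facts are known in this setting and may be taken as part of it: - $\Upsilon_M$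 is continuous and increasing; if $M$ is compact then $\mu(M)<\infty$; if $M$ is not compact then $\Upsilon_M(r)<\infty$ and $\Upsilon_M(r)+\Upsilon_M(s)\le\Upsilon_M(r+s)$ for all $r,s>0$, and $\mu(M)=\infty$. - (Weak isoperimetric inequality.) If $M$ is non-compact, there is $C>0$ such that for all $r>0$ and all Borel $A\subset M$ with $\mu(A)\le\Upsilon_M(r)$ one has $\mu(A)\le Cr\mu^+(A)$. If $M$ is compact, there is $C>0$ such that for all $r>0$: for all Borel $E$ with $\min\{\mu(E),\mu(E^c)\}\le\Upsilon_M(r)/2$ one has $\min\{\mu(E),\mu(E^c)\}\le Cr\mu^+(E)$; and for all Borel $E$ with $\mu(E)\le\Upsilon_M(r)$ and all Borel $A$ with $\mu(A)\le\mu(M)/2$ one has $\mu(A\cap E)\le Cr\mu^+(A)$. Isoperimetric weight. A positive measurable $w:M\to\mathbb{R}_+$ is an isoperimetric weight if there is a constant $C=C(w)$ such that $$\frac{\min\{\mu(\{w\le r\}),\mu(M)/2\}}{I(\min\{\mu(\{w\le r\}),\mu(M)/2\})}\le Cr\quad\text{for all } r>0,$$ the quotient being read as $0$ when $\mu(\{w\le r\})=0$. "Weight" means positive measurable function. *)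

theory Defs
  imports
    "HOL-Analysis.Analysis"
    "HOL-Algebra.Group_Action"
    "HOL-Algebra.Generated_Groups"
begin

section \<open>Perimeter, isoperimetric profile, isoperimetric weights\<close>

text \<open>The condition \<open>A \<noteq> {}\<close> is needed because the library puts \<open>infdist x {} = 0\<close>, whereas
  the distance to the empty set is to be read as infinite.\<close>

definition open_enlargement :: "'a::metric_space set \<Rightarrow> real \<Rightarrow> 'a set"
  where "open_enlargement A h = {x. A \<noteq> {} \<and> infdist x A < h}"

definition perimeter :: "'a::metric_space measure \<Rightarrow> 'a set \<Rightarrow> ennreal"
  where "perimeter M A =
    Liminf (at_right 0) (\<lambda>h. (emeasure M (open_enlargement A h) - emeasure M A) / ennreal h)"

definition isoperimetric_profile :: "'a::metric_space measure \<Rightarrow> real \<Rightarrow> ennreal"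
  where "isoperimetric_profile M t = (INF A \<in> {A \<in> sets M. emeasure M A = ennreal t}. perimeter M A)"

definition profile_domain :: "'a measure \<Rightarrow> real set"
  where "profile_domain M = {t. 0 \<le> t \<and> ennreal t < emeasure M (space M)}"

definition weight :: "'a measure \<Rightarrow> ('a \<Rightarrow> real) \<Rightarrow> bool"
  where "weight M w \<longleftrightarrow> w \<in> borel_measurable M \<and> (\<forall>x\<in>space M. 0 < w x)"

text \<open>In the following definition, \<open>v < \<infinity>\<close> can fail only for infinite total measure, and then
  says that the profile is evaluated inside its domain. For \<open>v = 0\<close> the quotient is \<open>0\<close> because
  its numerator is.\<close>

definition isoperimetric_weight :: "'a::metric_space measure \<Rightarrow> ('a \<Rightarrow> real) \<Rightarrow> bool"
  where "isoperimetric_weight M w \<longleftrightarrow> weight M w \<and>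
    (\<exists>C::real. \<forall>r>0.
      let v = min (emeasure M {x \<in> space M. w x \<le> r}) (emeasure M (space M) / 2)
      in v < \<infinity> \<and> enn2real v / enn2real (isoperimetric_profile M (enn2real v)) \<le> C * r)"


section \<open>Lie groups and finitely generated groups\<close>

text \<open>Points of Euclidean \<open>n\<close>-space are the sequences \<open>x :: nat \<Rightarrow> real\<close> with \<open>x i = 0\<close> for
  \<open>i \<ge> n\<close>, as in the library's \<open>Euclidean_space n\<close>. This makes the dimension a natural number, and
  allows \<open>n = 0\<close>. The domain \<open>U\<close> below is meant to be an open subset of that space.\<close>

primrec C_k_on :: "nat \<Rightarrow> nat \<Rightarrow> (nat \<Rightarrow> real) set \<Rightarrow> ((nat \<Rightarrow> real) \<Rightarrow> real) \<Rightarrow> bool"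
  where
    "C_k_on n 0 U f \<longleftrightarrow> continuous_map (subtopology (Euclidean_space n) U) euclideanreal f"
  | "C_k_on n (Suc k) U f \<longleftrightarrow>
      continuous_map (subtopology (Euclidean_space n) U) euclideanreal f \<and>
      (\<forall>i<n. \<exists>f'. (\<forall>x\<in>U. ((\<lambda>t. f (x(i := t))) has_real_derivative f' x) (at (x i))) \<and>
                  C_k_on n k U f')"

definition smooth_on ::
    "nat \<Rightarrow> nat \<Rightarrow> (nat \<Rightarrow> real) set \<Rightarrow> ((nat \<Rightarrow> real) \<Rightarrow> (nat \<Rightarrow> real)) \<Rightarrow> bool"
  where "smooth_on n m U F \<longleftrightarrow> (\<forall>j<m. \<forall>k. C_k_on n k U (\<lambda>x. F x j))"

definition smooth_atlas :: "nat \<Rightarrow> 'g topology \<Rightarrow> ('g set \<times> ('g \<Rightarrow> (nat \<Rightarrow> real))) set \<Rightarrow> bool"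
  where "smooth_atlas n T \<A> \<longleftrightarrow>
    (\<Union>(U, c)\<in>\<A>. U) = topspace T \<and>
    (\<forall>(U, c)\<in>\<A>. openin T U \<and>
       (\<exists>V. openin (Euclidean_space n) V \<and>
            homeomorphic_map (subtopology T U) (subtopology (Euclidean_space n) V) c)) \<and>
    (\<forall>(U, c)\<in>\<A>. \<forall>(U', c')\<in>\<A>. smooth_on n n (c ` (U \<inter> U')) (c' \<circ> inv_into U c))"

definition first_half :: "nat \<Rightarrow> (nat \<Rightarrow> real) \<Rightarrow> (nat \<Rightarrow> real)"
  where "first_half n z = (\<lambda>i. if i < n then z i else 0)"

definition second_half :: "nat \<Rightarrow> (nat \<Rightarrow> real) \<Rightarrow> (nat \<Rightarrow> real)"
  where "second_half n z = (\<lambda>i. if i < n then z (n + i) else 0)"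

definition topological_group :: "('g, 'm) monoid_scheme \<Rightarrow> 'g topology \<Rightarrow> bool"
  where "topological_group G T \<longleftrightarrow> group G \<and> topspace T = carrier G \<and>
    continuous_map (prod_topology T T) T (\<lambda>(g, h). g \<otimes>\<^bsub>G\<^esub> h) \<and>
    continuous_map T T (\<lambda>g. inv\<^bsub>G\<^esub> g)"

text \<open>Smoothness of the group operations is expressed by smoothness of \<open>(g, h) \<mapsto> g h\<^sup>-\<^sup>1\<close> in charts,
  \<open>G \<times> G\<close> being modelled on Euclidean \<open>2n\<close>-space.\<close>

definition lie_group :: "('g, 'm) monoid_scheme \<Rightarrow> 'g topology \<Rightarrow> bool"
  where "lie_group G T \<longleftrightarrow> topological_group G T \<and> Hausdorff_space T \<and> second_countable T \<and>
    (\<exists>n \<A>. smooth_atlas n T \<A> \<and>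
      (\<forall>(U, a)\<in>\<A>. \<forall>(V, b)\<in>\<A>. \<forall>(W, c)\<in>\<A>.
        let q = (\<lambda>z. inv_into U a (first_half n z) \<otimes>\<^bsub>G\<^esub> inv\<^bsub>G\<^esub> (inv_into V b (second_half n z)))
        in smooth_on (n + n) n
             {z \<in> topspace (Euclidean_space (n + n)).
                first_half n z \<in> a ` U \<and> second_half n z \<in> b ` V \<and> q z \<in> W}
             (c \<circ> q)))"

definition discrete_fg_group :: "('g, 'm) monoid_scheme \<Rightarrow> 'g topology \<Rightarrow> bool"
  where "discrete_fg_group G T \<longleftrightarrow> group G \<and> T = discrete_topology (carrier G) \<and>
    (\<exists>S. finite S \<and> S \<subseteq> carrier G \<and> generate G S = carrier G)"


section \<open>Homogeneous metric measure spaces\<close>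

definition local_slope :: "('a::metric_space \<Rightarrow> real) \<Rightarrow> 'a \<Rightarrow> ennreal"
  where "local_slope f x = Limsup (at x) (\<lambda>y. ennreal (\<bar>f y - f x\<bar> / dist y x))"

text \<open>\<open>grad f x\<close> stands for the modulus of the gradient of \<open>f\<close> at \<open>x\<close>. Compatibility with the
  distance means that it is the pointwise Lipschitz constant of \<open>f\<close>.\<close>

definition compatible_gradient :: "(('a::metric_space \<Rightarrow> real) \<Rightarrow> 'a \<Rightarrow> real) \<Rightarrow> bool"
  where "compatible_gradient grad \<longleftrightarrow>
    (\<forall>f L. L-lipschitz_on UNIV f \<longrightarrow> (\<forall>x. 0 \<le> grad f x \<and> ennreal (grad f x) = local_slope f x))"

text \<open>The volume of balls is used only for spaces in which it does not depend on the centre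
  (see \<open>emeasure_ball\<close> below), so the centre chosen here is immaterial.\<close>

definition ball_volume :: "'a::metric_space measure \<Rightarrow> real \<Rightarrow> ennreal"
  where "ball_volume M r = emeasure M (ball undefined r)"

text \<open>Monotonicity of the profile on either side of \<open>\<mu>(M)/2\<close> for finite measure is a consequence
  of concavity and symmetry.\<close>

locale isoperimetric_mms =
  fixes M :: "'a::metric_space measure"
  assumes connected_space: "connected (UNIV :: 'a set)"
    and sets_M: "sets M = sets borel"
    and finite_on_compact: "\<And>K. compact K \<Longrightarrow> emeasure M K < \<infinity>"
    and profile_finite: "\<And>t. t \<in> profile_domain M \<Longrightarrow> isoperimetric_profile M t < \<infinity>"
    and profile_concave:
      "concave_on (profile_domain M) (\<lambda>t. enn2real (isoperimetric_profile M t))"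
    and profile_continuous:
      "continuous_on (profile_domain M) (\<lambda>t. enn2real (isoperimetric_profile M t))"
    and profile_0: "isoperimetric_profile M 0 = 0"
    and profile_pos: "\<And>t. t \<in> profile_domain M \<Longrightarrow> 0 < t \<Longrightarrow> 0 < isoperimetric_profile M t"
    and profile_symmetric: "\<And>t. emeasure M (space M) < \<infinity> \<Longrightarrow> t \<in> profile_domain M \<Longrightarrow> 0 < t \<Longrightarrow>
      isoperimetric_profile M (measure M (space M) - t) = isoperimetric_profile M t"
    and profile_increasing: "emeasure M (space M) = \<infinity> \<Longrightarrow>
      mono_on (profile_domain M) (isoperimetric_profile M)"

text \<open>\<open>G\<close> with topology \<open>T\<close> acts by \<open>\<phi>\<close>. That the orbit maps are quotient maps means that \<open>M\<close> carries
  the topology of the coset space of \<open>G\<close> by an isotropy subgroup.\<close>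

locale homogeneous_mms = isoperimetric_mms M + transitive_action G "UNIV :: 'a set" \<phi>
  for M :: "'a::metric_space measure"
    and G :: "('g, 'm) monoid_scheme" (structure)
    and T :: "'g topology"
    and \<phi> :: "'g \<Rightarrow> 'a \<Rightarrow> 'a"
    and grad :: "('a \<Rightarrow> real) \<Rightarrow> 'a \<Rightarrow> real" +
  assumes lie_or_fg: "lie_group G T \<or> discrete_fg_group G T"
    and continuous_action: "continuous_map (prod_topology T euclidean) euclidean (\<lambda>(g, x). \<phi> g x)"
    and orbit_quotient: "\<And>x. quotient_map T euclidean (\<lambda>g. \<phi> g x)"
    and compact_isotropy: "\<And>x. compactin T (stabilizer G \<phi> x)"
    and measure_invariant:
      "\<And>g A. g \<in> carrier G \<Longrightarrow> A \<in> sets M \<Longrightarrow> emeasure M (\<phi> g ` A) = emeasure M A"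
    and dist_invariant: "\<And>g x y. g \<in> carrier G \<Longrightarrow> dist (\<phi> g x) (\<phi> g y) = dist x y"
    and gradient_compatible: "compatible_gradient grad"
    and gradient_invariant: "\<And>g f L x. g \<in> carrier G \<Longrightarrow> L-lipschitz_on UNIV f \<Longrightarrow>
      grad (f \<circ> \<phi> g) x = grad f (\<phi> g x)"
    and volume_continuous: "continuous_on {0<..} (ball_volume M)"
    and volume_increasing: "mono_on {0<..} (ball_volume M)"
    and compact_total: "compact (UNIV :: 'a set) \<Longrightarrow> emeasure M (space M) < \<infinity>"
    and noncompact_total: "\<not> compact (UNIV :: 'a set) \<Longrightarrow> emeasure M (space M) = \<infinity>"
    and noncompact_volume_finite:
      "\<And>r. \<not> compact (UNIV :: 'a set) \<Longrightarrow> 0 < r \<Longrightarrow> ball_volume M r < \<infinity>"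
    and noncompact_volume_superadditive:
      "\<And>r s. \<not> compact (UNIV :: 'a set) \<Longrightarrow> 0 < r \<Longrightarrow> 0 < s \<Longrightarrow>
        ball_volume M r + ball_volume M s \<le> ball_volume M (r + s)"
    and weak_isoperimetric_noncompact: "\<not> compact (UNIV :: 'a set) \<Longrightarrow>
      \<exists>C>0. \<forall>r>0. \<forall>A\<in>sets M. emeasure M A \<le> ball_volume M r \<longrightarrow>
        emeasure M A \<le> ennreal (C * r) * perimeter M A"
    and weak_isoperimetric_compact: "compact (UNIV :: 'a set) \<Longrightarrow>
      \<exists>C>0. \<forall>r>0.
        (\<forall>E\<in>sets M. min (emeasure M E) (emeasure M (- E)) \<le> ball_volume M r / 2 \<longrightarrow>
          min (emeasure M E) (emeasure M (- E)) \<le> ennreal (C * r) * perimeter M E) \<and>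
        (\<forall>E\<in>sets M. \<forall>A\<in>sets M.
          emeasure M E \<le> ball_volume M r \<longrightarrow> emeasure M A \<le> emeasure M (space M) / 2 \<longrightarrow>
          emeasure M (A \<inter> E) \<le> ennreal (C * r) * perimeter M A)"
begin

lemma emeasure_ball: "emeasure M (ball x r) = ball_volume M r"
proof -
  obtain g where g: "g \<in> carrier G" "\<phi> g undefined = x"
    using unique_orbit by blast
  have "\<phi> g ` ball undefined r = ball x r"
  proof (intro Set.set_eqI iffI)
    fix y assume "y \<in> \<phi> g ` ball undefined r"
    then show "y \<in> ball x r" using g dist_invariant by force
  next
    fix y assume y: "y \<in> ball x r"
    obtain z where "y = \<phi> g z" using surj_prop[OF g(1)] by blast
    with y g dist_invariant[OF g(1), of undefined z] show "y \<in> \<phi> g ` ball undefined r" by auto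
  qed
  then show ?thesis
    using measure_invariant[OF g(1), of "ball undefined r"]
    by (simp add: ball_volume_def sets_M)
qed

end

end

theory Submission
  imports Defs
begin

text \<open>If every set \<open>A\<close> of measure \<open>t\<close> satisfies \<open>t \<le> C r \<mu>\<^sup>+(A)\<close>, then \<open>t \<le> C r I(t)\<close>. For \<open>t\<close> the
  truncated measure of \<open>{w \<le> r}\<close> we have \<open>t \<le> \<Upsilon>(r)\<close>, so the weak isoperimetric inequality applies
  to all competitors; in the compact case one uses its second form with \<open>E = A\<close>, since the first
  would require \<open>t \<le> \<Upsilon>(r) / 2\<close>.\<close>

lemma div_profile_le:
  assumes "0 \<le> t" and "0 < c"
    and fin: "isoperimetric_profile M t < \<infinity>"
    and perim: "\<And>A. A \<in> sets M \<Longrightarrow> emeasure M A = ennreal t \<Longrightarrow> ennreal t \<le> ennreal c * perimeter M A"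
  shows "t / enn2real (isoperimetric_profile M t) \<le> c"
proof -
  have "ennreal (t / c) \<le> isoperimetric_profile M t"
    unfolding isoperimetric_profile_def
  proof (rule INF_greatest)
    fix A assume "A \<in> {A \<in> sets M. emeasure M A = ennreal t}"
    with perim have le: "ennreal t \<le> ennreal c * perimeter M A" by auto
    show "ennreal (t / c) \<le> perimeter M A"
    proof (cases "perimeter M A")
      case (real p)
      with le \<open>0 < c\<close> have "t \<le> c * p" by (simp flip: ennreal_mult)
      with real \<open>0 < c\<close> show ?thesis by (simp add: divide_le_eq mult.commute)
    qed simp
  qed
  \<comment> \<open>Finiteness is essential: \<open>enn2real\<close> sends \<infinity> to 0, which
    would destroy the lower bound.\<close>
  with fin assms(1,2) have "t / c \<le> enn2real (isoperimetric_profile M t)"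
    by (cases "isoperimetric_profile M t") auto
  \<comment> \<open>For \<open>t \<noteq> 0\<close> the bound \<open>t / c > 0\<close> keeps the
    denominator positive; for \<open>t = 0\<close> the quotient is 0.\<close>
  moreover have "t / enn2real (isoperimetric_profile M t) \<le> c" if "t \<noteq> 0"
    using calculation that assms(1,2)
    by (smt (verit) divide_pos_pos mult.commute pos_divide_le_eq)
  ultimately show ?thesis using \<open>0 < c\<close> by (cases "t = 0") auto
qed

context homogeneous_mms
begin

text \<open>Puts the compact and non-compact inequalities into one form, with \<open>C\<close>
  independent of \<open>r\<close>, so that the final argument needs no case split.\<close>

lemma weak_isoperimetric_half:
  obtains C where "0 < C"
    and "\<And>r A. 0 < r \<Longrightarrow> A \<in> sets M \<Longrightarrow> emeasure M A \<le> ball_volume M r \<Longrightarrow>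
      emeasure M A \<le> emeasure M (space M) / 2 \<Longrightarrow> emeasure M A \<le> ennreal (C * r) * perimeter M A"
proof (cases "compact (UNIV :: 'a set)")
  case True
  from weak_isoperimetric_compact[OF this] obtain C where "C > 0"
    and C: "\<And>r E A. 0 < r \<Longrightarrow> E \<in> sets M \<Longrightarrow> A \<in> sets M \<Longrightarrow> emeasure M E \<le> ball_volume M r \<Longrightarrow>
      emeasure M A \<le> emeasure M (space M) / 2 \<Longrightarrow>
      emeasure M (A \<inter> E) \<le> ennreal (C * r) * perimeter M A"
    by blast
  show ?thesis
    using that[OF \<open>C > 0\<close>] C by (metis Int_absorb)
next
  case False
  from weak_isoperimetric_noncompact[OF this] that show ?thesis by blast
qed

text \<open>In the compact case half the total measure is finite; otherwise the finite ball volume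
  bounds \<open>a\<close>.\<close>

lemma min_half_finite:
  assumes "0 < r" and "a \<le> ball_volume M r"
  shows "min a (emeasure M (space M) / 2) < \<infinity>"
proof (cases "compact (UNIV :: 'a set)")
  case True
  then have "emeasure M (space M) / 2 < \<infinity>"
    using compact_total by (simp add: ennreal_divide_eq_top_iff flip: less_top)
  then show ?thesis by (simp add: min_less_iff_disj)
next
  case False
  with assms noncompact_volume_finite show ?thesis
    by (meson le_less_trans min.strict_coboundedI1)
qed

text \<open>For finite total mass \<open>m\<close>, positivity of \<open>t\<close> makes
  \<open>t \<le> m / 2\<close> give \<open>t < m\<close>; for infinite mass every real is below
  it.\<close>

lemma profile_domain_half:
  assumes "0 < t" and "ennreal t \<le> emeasure M (space M) / 2"
  shows "t \<in> profile_domain M"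
proof (cases "emeasure M (space M)")
  case (real m)
  with assms have "t \<le> m / 2"
    by (metis divide_ennreal divide_nonneg_nonneg ennreal_le_iff ennreal_numeral zero_le_numeral
        zero_less_numeral)
  with real assms(1) show ?thesis
    by (auto simp: profile_domain_def intro!: ennreal_lessI)
next
  case top
  with assms(1) show ?thesis by (simp add: profile_domain_def)
qed

end

theorem theorem6:
  fixes M :: "'a::metric_space measure"
    and G :: "('g, 'm) monoid_scheme"
    and T :: "'g topology"
    and \<phi> :: "'g \<Rightarrow> 'a \<Rightarrow> 'a"
    and grad :: "('a \<Rightarrow> real) \<Rightarrow> 'a \<Rightarrow> real"
    and w :: "'a \<Rightarrow> real"
  assumes "homogeneous_mms M G T \<phi> grad"
    and "weight M w"
    and "\<And>r. 0 < r \<Longrightarrow> emeasure M {x \<in> space M. w x \<le> r} \<le> ball_volume M r"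
  shows "isoperimetric_weight M w"
proof -
  interpret homogeneous_mms M G T \<phi> grad by fact
  obtain C where "0 < C"
    and C: "\<And>r A. 0 < r \<Longrightarrow> A \<in> sets M \<Longrightarrow> emeasure M A \<le> ball_volume M r \<Longrightarrow>
      emeasure M A \<le> emeasure M (space M) / 2 \<Longrightarrow> emeasure M A \<le> ennreal (C * r) * perimeter M A"
    using weak_isoperimetric_half by blast
  define v where "v r = min (emeasure M {x \<in> space M. w x \<le> r}) (emeasure M (space M) / 2)" for r
  have "v r < \<infinity> \<and> enn2real (v r) / enn2real (isoperimetric_profile M (enn2real (v r))) \<le> C * r"
    if "0 < r" for r
  proof -
    have fin: "v r < \<infinity>"
      unfolding v_def using min_half_finite[OF \<open>0 < r\<close> assms(3)[OF \<open>0 < r\<close>]] .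
    define t where "t = enn2real (v r)"
    have t: "0 \<le> t" "ennreal t = v r"
      using fin by (simp_all add: t_def)
    have half: "ennreal t \<le> emeasure M (space M) / 2"
      by (simp add: t v_def)
    have volume: "ennreal t \<le> ball_volume M r"
      unfolding t v_def using assms(3)[OF \<open>0 < r\<close>] by (rule min.coboundedI1)
    \<comment> \<open>0 is in the profile's domain only if the total measure is positive, so
      \<open>t = 0\<close> is settled by \<open>profile_0\<close>.\<close>
    have "isoperimetric_profile M t < \<infinity>"
      using t(1) half profile_domain_half profile_finite profile_0
      by (cases "t = 0") auto
    moreover have "0 < C * r"
      using \<open>0 < C\<close> \<open>0 < r\<close> by simp
    \<comment> \<open>Every competitor has measure \<open>t\<close>, hence inherits both
      \<open>volume\<close> and \<open>half\<close>.\<close>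
    ultimately have "t / enn2real (isoperimetric_profile M t) \<le> C * r"
      using C[OF \<open>0 < r\<close>] volume half t(1) by (intro div_profile_le) metis+
    with fin show ?thesis by (simp add: t_def)
  qed
  with assms(2) show ?thesis
    unfolding isoperimetric_weight_def Let_def v_def by blast
qed

end
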